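(* Let $N\ge2$ and let $(S_i)_{i\in\mathbb{Z}_N}$ be a purely atomic representation of the Cuntz algebra $\mathcal{O}_N$ on a Hilbert space $\mathcal{H}$, with associated projection valued measure $P$. Suppose the representation is supported on a set $\Omega\subset\mathcal{K}_N$ that contains only periodic points. The following statements are equivalent: (i) The representation is permutative. (ii) For every cycle $\omega=\underline{\omega_1\dots\omega_p}$ in the support $\Omega$, there exists an orthonormal basis $O_\omega=\{e_i:i\in I_\omega\}$ for $P(\omega)\mathcal{H}$ such that $S_{\omega_1}\cdots S_{\omega_p}O_\omega=O_\omega$.
   Context: $\mathbb{Z}_N=\{0,1,\dots,N-1\}$. A representation of the Cuntz algebra $\mathcal{O}_N$ on a Hilbert space $\mathcal{H}$ is a family $(S_i)_{i\in\mathbb{Z}_N}$ of bounded operators on $\mathcal{H}$ with $S_i^*S_j=\delta_{ij}I$ for all $i,j$ and $\sum_{i\in\mathbb{Z}_N}S_iS_i^*=I$. For a finite word $I=i_1\dots i_n$, $S_I:=S_{i_1}\cdots S_{i_n}$. $\mathcal{K}_N=\mathbb{Z}_N^{\mathbb{N}}$ is the space of infinite words with the product topology and $\sigma(\omega_1\omega_2\dots)=\omega_2\omega_3\dots$ is the shift. The projection valued measure $P$ associated to the representation is the unique projection valued measure on the Borel sets of $\mathcal{K}_N$ with $P(\{\omega:\omega_1=i_1,\dots,\omega_k=i_k\})=S_IS_I^*$ for every finite word $I=i_1\dots i_k$. Write $P(\omega)=P(\{\omega\})$. The representation is purely atomic and supported on $\Omega\subset\mathcal{K}_N$ if $\oplus_{\omega\in\Omega}P(\omega)=I$.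 A word $\omega\in\mathcal{K}_N$ is periodic if $\sigma^k(\omega)=\sigma^{k'}(\omega)$ for some non-negative integers $k\neq k'$; it is cyclic (a cycle) if $\sigma^p(\omega)=\omega$ for some $p>0$, in which case $\omega$ is the infinite repetition of $\omega_1\dots\omega_p$, written $\omega=\underline{\omega_1\dots\omega_p}$. A representation is permutative if there is an orthonormal basis $\{e_\lambda:\lambda\in\Lambda\}$ of $\mathcal{H}$ such that for all $\lambda\in\Lambda$, $j\in\mathbb{Z}_N$, $S_je_\lambda$ is an element of this basis. *)

theory Defs
  imports "HOL-Analysis.Analysis"
begin

section \<open>Complex Hilbert spaces\<close>

text \<open>
  The complex inner product is antilinear in the first and linear in the second argument. Its real
  part is the real inner product of the superclass, so that norm, metric and topology are
  those induced by \<open>cinner\<close>.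
\<close>

class complex_inner = real_inner +
  fixes scaleC :: "complex \<Rightarrow> 'a \<Rightarrow> 'a"  (infixr \<open>*\<^sub>C\<close> 75)
    and cinner :: "'a \<Rightarrow> 'a \<Rightarrow> complex"
  assumes scaleC_add_right: "c *\<^sub>C (x + y) = c *\<^sub>C x + c *\<^sub>C y"
    and scaleC_add_left: "(c + d) *\<^sub>C x = c *\<^sub>C x + d *\<^sub>C x"
    and scaleC_scaleC: "c *\<^sub>C (d *\<^sub>C x) = (c * d) *\<^sub>C x"
    and scaleC_of_real: "complex_of_real r *\<^sub>C x = r *\<^sub>R x"
    and cinner_commute: "cinner x y = cnj (cinner y x)"
    and cinner_add_right: "cinner x (y + z) = cinner x y + cinner x z"
    and cinner_scaleC_right: "cinner x (c *\<^sub>C y) = c * cinner x y"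
    and Re_cinner: "Re (cinner x y) = x \<bullet> y"

class complex_hilbert = complex_inner + complete_space

global_interpretation complex_vector: vector_space "scaleC :: complex \<Rightarrow> 'a \<Rightarrow> 'a::complex_inner"
proof
  fix x :: 'a
  show "1 *\<^sub>C x = x"
    using scaleC_of_real[of 1 x] by simp
qed (simp_all add: scaleC_add_right scaleC_add_left scaleC_scaleC)

definition bounded_clinear :: "('h::complex_inner \<Rightarrow> 'h) \<Rightarrow> bool" where
  "bounded_clinear T \<longleftrightarrow> bounded_linear T \<and> (\<forall>c x. T (c *\<^sub>C x) = c *\<^sub>C T x)"

text \<open>
  On a Hilbert space a bounded operator has exactly one adjoint.
\<close>

definition cadjoint :: "('h::complex_inner \<Rightarrow> 'h) \<Rightarrow> 'h \<Rightarrow> 'h" where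
  "cadjoint T = (THE T'. \<forall>x y. cinner (T' x) y = cinner x (T y))"

definition orthogonal_projection :: "('h::complex_inner \<Rightarrow> 'h) \<Rightarrow> bool" where
  "orthogonal_projection Q \<longleftrightarrow> bounded_clinear Q \<and> Q \<circ> Q = Q \<and> cadjoint Q = Q"

definition orthonormal_basis_of :: "'h::complex_inner set \<Rightarrow> 'h set \<Rightarrow> bool" where
  "orthonormal_basis_of M B \<longleftrightarrow>
     (\<forall>x\<in>B. \<forall>y\<in>B. cinner x y = (if x = y then 1 else 0)) \<and>
     closure (complex_vector.span B) = M"


section \<open>Representations of the Cuntz algebra\<close>

definition cuntz_representation :: "nat \<Rightarrow> (nat \<Rightarrow> 'h::complex_hilbert \<Rightarrow> 'h) \<Rightarrow> bool" where
  "cuntz_representation N S \<longleftrightarrow>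
     (\<forall>i<N. bounded_clinear (S i)) \<and>
     (\<forall>i<N. \<forall>j<N. cadjoint (S i) \<circ> S j = (if i = j then id else (\<lambda>_. 0))) \<and>
     (\<forall>x. (\<Sum>i<N. S i (cadjoint (S i) x)) = x)"

definition word_op :: "(nat \<Rightarrow> 'h \<Rightarrow> 'h) \<Rightarrow> nat list \<Rightarrow> 'h \<Rightarrow> 'h" where
  "word_op S I = foldr (\<lambda>i T. S i \<circ> T) I id"

definition permutative :: "nat \<Rightarrow> (nat \<Rightarrow> 'h::complex_hilbert \<Rightarrow> 'h) \<Rightarrow> bool" where
  "permutative N S \<longleftrightarrow>
     (\<exists>B. orthonormal_basis_of UNIV B \<and> (\<forall>e\<in>B. \<forall>j<N. S j e \<in> B))"


section \<open>Infinite words\<close>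

text \<open>
  Positions are counted from 0: the letter \<open>\<omega>\<^sub>k\<close> of a word (\<open>k \<ge> 1\<close>) is \<open>\<omega> (k - 1)\<close>.
\<close>

definition words :: "nat \<Rightarrow> (nat \<Rightarrow> nat) set" where
  "words N = {\<omega>. \<forall>n. \<omega> n < N}"

definition shift :: "(nat \<Rightarrow> nat) \<Rightarrow> nat \<Rightarrow> nat" where
  "shift \<omega> = (\<lambda>n. \<omega> (Suc n))"

definition periodic :: "(nat \<Rightarrow> nat) \<Rightarrow> bool" where
  "periodic \<omega> \<longleftrightarrow> (\<exists>k k'. k \<noteq> k' \<and> (shift ^^ k) \<omega> = (shift ^^ k') \<omega>)"

definition cylinder :: "nat \<Rightarrow> nat list \<Rightarrow> (nat \<Rightarrow> nat) set" where
  "cylinder N I = {\<omega> \<in> words N. \<forall>k<length I. \<omega> k = I ! k}"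

text \<open>
  The type \<open>nat \<Rightarrow> nat\<close> carries the product of the discrete topologies, and
  \<open>words N\<close> the subspace topology.
\<close>

definition borel_words :: "nat \<Rightarrow> (nat \<Rightarrow> nat) measure" where
  "borel_words N = restrict_space borel (words N)"


section \<open>The associated projection valued measure\<close>

definition projection_valued_measure ::
    "'a measure \<Rightarrow> ('a set \<Rightarrow> 'h::complex_hilbert \<Rightarrow> 'h) \<Rightarrow> bool" where
  "projection_valued_measure M P \<longleftrightarrow>
     (\<forall>A\<in>sets M. orthogonal_projection (P A)) \<and>
     P {} = (\<lambda>_. 0) \<and> P (space M) = id \<and>
     (\<forall>A\<in>sets M. \<forall>B\<in>sets M. P (A \<inter> B) = P A \<circ> P B) \<and>
     (\<forall>A :: nat \<Rightarrow> 'a set. range A \<subseteq> sets M \<longrightarrow> disjoint_family A \<longrightarrow>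
        (\<forall>x. (\<lambda>n. P (A n) x) sums P (\<Union>n. A n) x))"

text \<open>
  The conditions below determine \<open>P\<close> uniquely on the Borel sets, so they characterise the
  projection valued measure associated to the representation; values of \<open>P\<close> at
  other sets are immaterial.
\<close>

definition associated_pvm ::
    "nat \<Rightarrow> (nat \<Rightarrow> 'h::complex_hilbert \<Rightarrow> 'h) \<Rightarrow> ((nat \<Rightarrow> nat) set \<Rightarrow> 'h \<Rightarrow> 'h) \<Rightarrow> bool" where
  "associated_pvm N S P \<longleftrightarrow>
     projection_valued_measure (borel_words N) P \<and>
     (\<forall>I. set I \<subseteq> {..<N} \<longrightarrow> P (cylinder N I) = word_op S I \<circ> cadjoint (word_op S I))"

text \<open>
  The sum of projections is taken in the strong operator topology.
\<close>

definition purely_atomic_on ::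
    "((nat \<Rightarrow> nat) set \<Rightarrow> 'h::complex_hilbert \<Rightarrow> 'h) \<Rightarrow> (nat \<Rightarrow> nat) set \<Rightarrow> bool" where
  "purely_atomic_on P \<Omega> \<longleftrightarrow> (\<forall>x. ((\<lambda>\<omega>. P {\<omega>} x) has_sum x) \<Omega>)"

end

theory Submission
  imports Defs
begin

text \<open>
  Call the range of \<open>P {\<omega>}\<close> the atom of \<open>\<omega>\<close>. Countable additivity identifies it with the intersection of
  the ranges of the operators of the finite prefixes of \<open>\<omega>\<close> (\<open>atom_iff\<close>). Consequently
  \<open>S (\<omega> 0)\<close> maps the atom of \<open>shift \<omega>\<close> isometrically onto the atom of \<open>\<omega>\<close> (\<open>atom_shift\<close>), and atoms of
  different words are orthogonal. A cyclic word of period \<open>p\<close> thus has an atom on which the operator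
  of its first \<open>p\<close> letters acts unitarily; the theorem says that it is enough to look at these unitaries.

  Let \<open>B\<close> be a basis that the isometries map into itself. The images \<open>S j ` B\<close> exhaust \<open>B\<close>, because their
  ranges span the space. So every basis vector has an infinite address, and for each \<open>\<omega>\<close> it lies in
  the atom of \<open>\<omega>\<close> or is annihilated by \<open>P {\<omega>}\<close> (\<open>basis_vector_in_atom\<close>). Therefore the basis vectors in
  the atom form a basis of it, and unique decomposition of basis vectors shows that a
  full turn of the cycle permutes them (\<open>cycle_permutes_basis_of_atom\<close>).

  Conversely, every periodic word runs into exactly one cycle. Fix one point \<open>c\<close> on each cycle and an
  invariant basis of its atom. Transport this basis to a word \<open>\<omega>\<close> along the prefix of \<open>\<omega>\<close>
  that precedes the first visit to \<open>c\<close>. An isometry \<open>S j\<close> sends the transported basis of \<open>\<omega>\<close> to that of the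
  word \<open>j\<omega>\<close>: either the prefix grows by the letter \<open>j\<close>, or \<open>j\<omega> = c\<close> and the prefix has become one minimal
  period of \<open>c\<close>, whose operator fixes the chosen basis as a set (\<open>S_transported_basis\<close>). The
  union of the transported bases is orthonormal because atoms are mutually orthogonal, and total
  because the atoms over \<open>\<Omega>\<close> span the space.

  Adjoints are introduced by a definite description, so their existence has to be established
  beforehand; it rests on the Riesz representation theorem (\<open>riesz_representation\<close>).
\<close>

section \<open>Hilbert space preliminaries\<close>

lemma cinner_scaleC_left: "cinner (c *\<^sub>C x) y = cnj c * cinner (x::'h::complex_inner) y"
  by (metis cinner_commute cinner_scaleC_right complex_cnj_mult)

lemma cinner_zero_right [simp]: "cinner (x::'h::complex_inner) 0 = 0"
  by (metis add_cancel_right_right cinner_add_right)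

lemma cinner_zero_left [simp]: "cinner 0 (x::'h::complex_inner) = 0"
  by (metis cinner_commute cinner_zero_right complex_cnj_zero)

lemma cinner_eq_Complex:
  "cinner x y = Complex (x \<bullet> y) (x \<bullet> ((- \<i>) *\<^sub>C (y::'h::complex_inner)))"
proof -
  have "Im (cinner x y) = Re (cinner x ((- \<i>) *\<^sub>C y))"
    by (simp only: cinner_scaleC_right) simp
  then show ?thesis
    by (simp add: Re_cinner complex_eq_iff)
qed

lemma cinner_self_eq_0_iff [simp]: "cinner x x = 0 \<longleftrightarrow> (x::'h::complex_inner) = 0"
  by (metis Re_cinner cinner_zero_right inner_eq_zero_iff zero_complex.simps(1))

lemma cinner_ext:
  assumes "\<And>y. cinner x y = cinner x' y"
  shows "x = (x'::'h::complex_inner)"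
proof -
  have "x \<bullet> y = x' \<bullet> y" for y
    using assms by (metis Re_cinner)
  then have "(x - x') \<bullet> (x - x') = 0"
    by (simp add: inner_diff_left)
  then show ?thesis by simp
qed

lemma norm_scaleC: "norm (c *\<^sub>C x) = cmod c * norm (x::'h::complex_inner)"
proof -
  have "(norm (c *\<^sub>C x))\<^sup>2 = Re (cinner (c *\<^sub>C x) (c *\<^sub>C x))"
    by (simp add: Re_cinner power2_norm_eq_inner)
  also have "\<dots> = Re (complex_of_real ((cmod c)\<^sup>2) * cinner x x)"
    by (simp only: cinner_scaleC_left cinner_scaleC_right mult.assoc[symmetric] complex_norm_square)
  also have "\<dots> = (cmod c * norm x)\<^sup>2"
    by (simp add: Re_cinner power2_norm_eq_inner power_mult_distrib)
  finally show ?thesis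
    by (simp add: power2_eq_iff_nonneg)
qed

lemma bounded_linear_scaleC: "bounded_linear (\<lambda>x::'h::complex_inner. c *\<^sub>C x)"
proof (rule bounded_linear_intro)
  fix r and x y :: 'h
  show "c *\<^sub>C (x + y) = c *\<^sub>C x + c *\<^sub>C y" by (rule scaleC_add_right)
  show "c *\<^sub>C (r *\<^sub>R x) = r *\<^sub>R c *\<^sub>C x"
    by (simp only: scaleC_of_real[symmetric] scaleC_scaleC mult.commute)
  show "norm (c *\<^sub>C x) \<le> norm x * cmod c" by (simp add: norm_scaleC)
qed

lemma continuous_on_cinner_right: "continuous_on A (\<lambda>y::'h::complex_inner. cinner x y)"
  unfolding cinner_eq_Complex Complex_eq
  by (intro continuous_intros bounded_linear.continuous_on[OF bounded_linear_scaleC])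

lemma closed_orthogonal_complement: "closed {y::'h::complex_inner. cinner x y = 0}"
  using continuous_closed_preimage_constant[OF continuous_on_cinner_right closed_UNIV, of x 0]
  by simp

lemma subspace_orthogonal_complement:
  "complex_vector.subspace {y::'h::complex_inner. cinner x y = 0}"
  by (auto simp: complex_vector.subspace_def cinner_add_right cinner_scaleC_right)

lemma subspace_closure:
  assumes "complex_vector.subspace (M::'h::complex_inner set)"
  shows "complex_vector.subspace (closure M)"
  unfolding complex_vector.subspace_def
proof (intro conjI ballI allI)
  show "0 \<in> closure M"
    using assms closure_subset complex_vector.subspace_0 by blast
next
  fix x y assume "x \<in> closure M" "y \<in> closure M"
  then obtain f g where "\<forall>n. f n \<in> M" "f \<longlonglongrightarrow> x" "\<forall>n. g n \<in> M" "g \<longlonglongrightarrow> y"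
    unfolding closure_sequential by blast
  then show "x + y \<in> closure M"
    unfolding closure_sequential
    by (intro exI[of _ "\<lambda>n. f n + g n"]) (auto intro: tendsto_add complex_vector.subspace_add[OF assms])
next
  fix c x assume "x \<in> closure M"
  then obtain f where "\<forall>n. f n \<in> M" "f \<longlonglongrightarrow> x"
    unfolding closure_sequential by blast
  then show "c *\<^sub>C x \<in> closure M"
    unfolding closure_sequential
    by (intro exI[of _ "\<lambda>n. c *\<^sub>C f n"])
       (auto intro: bounded_linear.tendsto[OF bounded_linear_scaleC] complex_vector.subspace_scale[OF assms])
qed

lemma closure_span_minimal:
  assumes "B \<subseteq> M" "closed M" "complex_vector.subspace (M::'h::complex_inner set)"
  shows "closure (complex_vector.span B) \<subseteq> M"
  using assms by (intro closure_minimal complex_vector.span_minimal)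

lemma subset_closure_span: "B \<subseteq> closure (complex_vector.span (B::'h::complex_inner set))"
  using complex_vector.span_superset closure_subset by (rule subset_trans)

lemma bounded_clinear_zero: "bounded_clinear T \<Longrightarrow> T 0 = (0::'h::complex_inner)"
  unfolding bounded_clinear_def by (auto dest: bounded_linear.linear linear_0)

lemma bounded_clinear_add: "bounded_clinear T \<Longrightarrow> T (x + y) = T x + T (y::'h::complex_inner)"
  unfolding bounded_clinear_def by (auto dest: bounded_linear.linear linear_add)

lemma bounded_clinear_scaleC: "bounded_clinear T \<Longrightarrow> T (c *\<^sub>C x) = c *\<^sub>C T (x::'h::complex_inner)"
  unfolding bounded_clinear_def by auto

lemma continuous_on_bounded_clinear: "bounded_clinear T \<Longrightarrow> continuous_on A (T :: 'h::complex_inner \<Rightarrow> 'h)"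
  unfolding bounded_clinear_def by (auto intro: linear_continuous_on)

lemma bounded_clinear_id: "bounded_clinear (id :: 'h::complex_inner \<Rightarrow> 'h)"
  by (simp add: bounded_clinear_def id_def bounded_linear_ident)

lemma bounded_clinear_compose:
  "bounded_clinear T \<Longrightarrow> bounded_clinear U \<Longrightarrow> bounded_clinear (T \<circ> U :: 'h::complex_inner \<Rightarrow> 'h)"
  unfolding bounded_clinear_def using bounded_linear_compose[of T U] by (auto simp: o_def)

text \<open>
  Preimages of closed subspaces are closed subspaces, so mapping into one can be tested on a
  spanning set; this turns the density arguments below into checks on basis vectors.
\<close>

lemma bounded_clinear_closure_span:
  assumes T: "bounded_clinear (T :: 'h::complex_inner \<Rightarrow> 'h)"
    and M: "closed M" "complex_vector.subspace M" "T ` B \<subseteq> M"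
    and x: "x \<in> closure (complex_vector.span B)"
  shows "T x \<in> M"
proof -
  have "closure (complex_vector.span B) \<subseteq> T -` M"
  proof (rule closure_span_minimal)
    show "B \<subseteq> T -` M" using M by auto
    show "closed (T -` M)"
      using continuous_on_bounded_clinear[OF T] M(1) by (simp add: closed_vimage)
    show "complex_vector.subspace (T -` M)"
      using M(2) by (auto simp: complex_vector.subspace_def bounded_clinear_zero[OF T]
          bounded_clinear_add[OF T] bounded_clinear_scaleC[OF T])
  qed
  with x show ?thesis by auto
qed

section \<open>Riesz representation and adjoints\<close>

text \<open>
  The representing vector minimises the energy \<open>\<parallel>x\<parallel>\<^sup>2 - 2 f x\<close>: the parallelogram law makes
  every minimising sequence Cauchy, and the first variation of the energy vanishes at the minimiser.
\<close>

lemma riesz_representation: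
  fixes f :: "'h::{real_inner, complete_space} \<Rightarrow> real"
  assumes f: "bounded_linear f"
  shows "\<exists>v. \<forall>y. f y = v \<bullet> y"
proof -
  interpret f: bounded_linear f by fact
  define \<phi> where "\<phi> x = x \<bullet> x - 2 * f x" for x
  obtain K where K: "\<And>x. norm (f x) \<le> norm x * K"
    using f.bounded by blast
  have "- (K\<^sup>2) \<le> \<phi> x" for x
  proof -
    have "f x \<le> norm x * K" using K[of x] by simp
    moreover have "0 \<le> (norm x - K)\<^sup>2" by simp
    ultimately show ?thesis
      unfolding \<phi>_def by (simp add: power2_eq_square power2_norm_eq_inner[symmetric] algebra_simps)
  qed
  then have bdd: "bdd_below (range \<phi>)" by (intro bdd_belowI2)
  define m where "m = Inf (range \<phi>)"
  have m_le: "m \<le> \<phi> x" for x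
    unfolding m_def by (rule cInf_lower[OF _ bdd]) simp
  have "\<exists>x. \<phi> x < m + inverse (real (Suc n))" for n
    using cInf_lessD[of "range \<phi>" "m + inverse (real (Suc n))"] m_def
    by (auto simp del: of_nat_Suc)
  then have "\<forall>n. \<exists>x. \<phi> x < m + inverse (real (Suc n))" by blast
  from choice[OF this] obtain u where u: "\<And>n. \<phi> (u n) < m + inverse (real (Suc n))" by blast
  have parallelogram: "(norm (x - y))\<^sup>2 \<le> 2 * \<phi> x + 2 * \<phi> y - 4 * m" for x y
  proof -
    have "(norm (x - y))\<^sup>2 = 2 * \<phi> x + 2 * \<phi> y - 4 * \<phi> ((1/2) *\<^sub>R (x + y))"
      unfolding \<phi>_def power2_norm_eq_inner
      by (simp add: f.add f.scaleR inner_add_left inner_add_right inner_diff_left inner_diff_right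
          inner_commute algebra_simps)
    with m_le[of "(1/2) *\<^sub>R (x + y)"] show ?thesis by linarith
  qed
  have "Cauchy u"
  proof (rule metric_CauchyI)
    fix e :: real assume "e > 0"
    then obtain M where M: "inverse (real (Suc M)) < e\<^sup>2 / 4"
      using reals_Archimedean[of "e\<^sup>2 / 4"] by auto
    have "dist (u k) (u n) < e" if "k \<ge> M" "n \<ge> M" for k n
    proof -
      have "inverse (real (Suc j)) \<le> inverse (real (Suc M))" if "j \<ge> M" for j
        using that by (intro le_imp_inverse_le) auto
      from this[OF that(1)] this[OF that(2)] have "(norm (u k - u n))\<^sup>2 < e\<^sup>2"
        using parallelogram[of "u k" "u n"] u[of k] u[of n] M by linarith
      then show ?thesis
        using \<open>e > 0\<close> by (simp add: dist_norm power_less_imp_less_base)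
    qed
    then show "\<exists>M. \<forall>m\<ge>M. \<forall>n\<ge>M. dist (u m) (u n) < e" by blast
  qed
  then obtain v where v: "u \<longlonglongrightarrow> v"
    by (auto simp: Cauchy_convergent_iff convergent_def)
  have "(\<lambda>n. \<phi> (u n)) \<longlonglongrightarrow> \<phi> v"
    unfolding \<phi>_def by (intro tendsto_intros f.tendsto v)
  moreover have "(\<lambda>n. m + inverse (real (Suc n))) \<longlonglongrightarrow> m + 0"
    by (intro tendsto_intros LIMSEQ_inverse_real_of_nat)
  ultimately have v_le: "\<phi> v \<le> m"
    using u by (intro LIMSEQ_le[of "\<lambda>n. \<phi> (u n)"]) (auto intro: less_imp_le)
  have "f y = v \<bullet> y" for y
  proof -
    define d where "d = v \<bullet> y - f y"
    define Y where "Y = y \<bullet> y"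
    \<comment> \<open>This step length stays defined for \<open>y = 0\<close>, and it lowers the energy strictly unless \<open>d = 0\<close>.\<close>
    define t where "t = - d / (Y + 1)"
    have Y: "Y \<ge> 0" by (simp add: Y_def)
    have "\<phi> (v + t *\<^sub>R y) = \<phi> v + 2 * t * d + t\<^sup>2 * Y"
      unfolding \<phi>_def d_def Y_def
      by (simp add: f.add f.scaleR inner_add_left inner_add_right inner_commute
          power2_eq_square algebra_simps)
    with m_le[of "v + t *\<^sub>R y"] v_le have "0 \<le> 2 * t * d + t\<^sup>2 * Y" by linarith
    then have "0 \<le> (2 * t * d + t\<^sup>2 * Y) * (Y + 1)\<^sup>2"
      by (rule mult_nonneg_nonneg) simp
    also have "\<dots> = 2 * (t * (Y + 1)) * d * (Y + 1) + (t * (Y + 1))\<^sup>2 * Y"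
      by algebra
    also have "t * (Y + 1) = - d"
      using Y by (simp add: t_def)
    finally have "d\<^sup>2 * (Y + 2) \<le> 0"
      by (simp add: algebra_simps power2_eq_square)
    then have "d = 0" using Y by (simp add: mult_le_0_iff)
    then show ?thesis by (simp add: d_def)
  qed
  then show ?thesis by blast
qed

text \<open>
  The definite description in \<open>cadjoint\<close> denotes an adjoint only once existence is known; existence
  comes from Riesz for the real inner product, and complex linearity of \<open>T\<close> carries
  the identity over to the imaginary part.
\<close>

lemma cinner_cadjoint:
  fixes T :: "'h::complex_hilbert \<Rightarrow> 'h"
  assumes "bounded_clinear T"
  shows "cinner (cadjoint T x) y = cinner x (T y)"
proof -
  have "\<exists>v. \<forall>y. x \<bullet> T y = v \<bullet> y" for x
    using assms unfolding bounded_clinear_def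
    by (intro riesz_representation bounded_linear_compose[OF bounded_linear_inner_right]) auto
  then obtain T' where T': "\<And>x y. x \<bullet> T y = T' x \<bullet> y" by metis
  have "cinner (T' x) y = cinner x (T y)" for x y
    unfolding cinner_eq_Complex T'[symmetric] bounded_clinear_scaleC[OF assms] ..
  then have ex: "\<forall>x y. cinner (T' x) y = cinner x (T y)" by blast
  moreover have "U = T'" if "\<forall>x y. cinner (U x) y = cinner x (T y)" for U
    using that ex by (intro ext cinner_ext) auto
  ultimately have "\<forall>x y. cinner (cadjoint T x) y = cinner x (T y)"
    unfolding cadjoint_def by (rule theI)
  then show ?thesis by blast
qed

lemma cadjoint_isometry:
  fixes T :: "'h::complex_hilbert \<Rightarrow> 'h"
  assumes "bounded_clinear T" "\<And>x y. cinner (T x) (T y) = cinner x y"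
  shows "cadjoint T (T x) = x"
  by (rule cinner_ext) (simp add: cinner_cadjoint assms)

section \<open>Orthonormal bases\<close>

lemma orthonormal_basis_ofI:
  assumes "\<And>x y. x \<in> B \<Longrightarrow> y \<in> B \<Longrightarrow> cinner x y = (if x = y then 1 else 0)"
    and "B \<subseteq> M" "closed M" "complex_vector.subspace M" "M \<subseteq> closure (complex_vector.span B)"
  shows "orthonormal_basis_of M (B::'h::complex_inner set)"
  unfolding orthonormal_basis_of_def using closure_span_minimal[of B M] assms by auto

lemma orthonormal_basis_of_isometric_image:
  fixes T :: "'h::complex_inner \<Rightarrow> 'h"
  assumes B: "orthonormal_basis_of M B"
    and T: "bounded_clinear T" "\<And>x y. cinner (T x) (T y) = cinner x y"
    and cl: "closed (T ` M)"
  shows "orthonormal_basis_of (T ` M) (T ` B)"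
proof (rule orthonormal_basis_ofI)
  fix x y assume "x \<in> T ` B" "y \<in> T ` B"
  then obtain a b where ab: "a \<in> B" "b \<in> B" "x = T a" "y = T b" by blast
  then have *: "cinner x y = (if a = b then 1 else 0)"
    using B by (auto simp: T(2) orthonormal_basis_of_def)
  moreover have "cinner x x = 1"
    using B ab by (simp add: T(2) orthonormal_basis_of_def)
  ultimately show "cinner x y = (if x = y then 1 else 0)" using ab by auto
next
  have M: "M = closure (complex_vector.span B)"
    using B by (auto simp: orthonormal_basis_of_def)
  show "T ` B \<subseteq> T ` M"
    unfolding M by (intro image_mono subset_closure_span)
  have sub: "complex_vector.subspace M"
    unfolding M by (intro subspace_closure complex_vector.subspace_span)
  show "complex_vector.subspace (T ` M)"
    unfolding complex_vector.subspace_def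
  proof (intro conjI ballI allI)
    show "0 \<in> T ` M"
      using bounded_clinear_zero[OF T(1)] complex_vector.subspace_0[OF sub] by (metis imageI)
  next
    fix x y assume "x \<in> T ` M" "y \<in> T ` M"
    then show "x + y \<in> T ` M"
      using complex_vector.subspace_add[OF sub]
      by (auto simp: bounded_clinear_add[OF T(1), symmetric])
  next
    fix c x assume "x \<in> T ` M"
    then show "c *\<^sub>C x \<in> T ` M"
      using complex_vector.subspace_scale[OF sub]
      by (auto simp: bounded_clinear_scaleC[OF T(1), symmetric])
  qed
  show "T ` M \<subseteq> closure (complex_vector.span (T ` B))"
  proof (rule image_subsetI)
    fix x assume "x \<in> M"
    then have "x \<in> closure (complex_vector.span B)" unfolding M .
    then show "T x \<in> closure (complex_vector.span (T ` B))"
      by (rule bounded_clinear_closure_span[OF T(1) closed_closure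
            subspace_closure[OF complex_vector.subspace_span] subset_closure_span])
  qed
qed (rule cl)

section \<open>Periodic words and the orbits of the shift\<close>

definition cyclic :: "(nat \<Rightarrow> nat) \<Rightarrow> bool" where
  "cyclic c \<longleftrightarrow> (\<exists>p>0. (shift ^^ p) c = c)"

definition period :: "(nat \<Rightarrow> nat) \<Rightarrow> nat" where
  "period c = (LEAST p. p > 0 \<and> (shift ^^ p) c = c)"

text \<open>
  The chosen cyclic word depends on the shift orbit only, because the condition is that \<open>\<omega>\<close> and \<open>c\<close>
  have a common tail. All words that run into one cycle therefore agree on a single
  point of that cycle.
\<close>

definition tail_rep :: "(nat \<Rightarrow> nat) \<Rightarrow> nat \<Rightarrow> nat" where
  "tail_rep \<omega> = (SOME c. cyclic c \<and> (\<exists>m n. (shift ^^ m) \<omega> = (shift ^^ n) c))"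

definition entry_time :: "(nat \<Rightarrow> nat) \<Rightarrow> nat" where
  "entry_time \<omega> = (LEAST k. (shift ^^ k) \<omega> = tail_rep \<omega>)"

lemma shift_period: "cyclic c \<Longrightarrow> period c > 0 \<and> (shift ^^ period c) c = c"
  unfolding cyclic_def period_def by (rule LeastI_ex) auto

lemma shift_case_nat [simp]: "shift (case_nat j \<omega>) = \<omega>"
  by (simp add: shift_def)

lemma shift_funpow_words: "\<omega> \<in> words N \<Longrightarrow> (shift ^^ k) \<omega> \<in> words N"
  by (induction k) (auto simp: words_def shift_def)

lemma shift_words: "\<omega> \<in> words N \<Longrightarrow> shift \<omega> \<in> words N"
  by (auto simp: words_def shift_def)

lemma case_nat_words: "j < N \<Longrightarrow> \<omega> \<in> words N \<Longrightarrow> case_nat j \<omega> \<in> words N"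
  by (auto simp: words_def split: nat.split)

lemma periodic_of_periodic_shift:
  assumes "periodic (shift \<omega>)"
  shows "periodic \<omega>"
proof -
  obtain k k' where "k \<noteq> k'" "(shift ^^ k) (shift \<omega>) = (shift ^^ k') (shift \<omega>)"
    using assms unfolding periodic_def by blast
  then show ?thesis
    unfolding periodic_def
    by (intro exI[of _ "Suc k"] exI[of _ "Suc k'"]) (simp add: funpow_swap1)
qed

lemma prefix_Suc: "map \<omega> [0..<Suc n] = \<omega> 0 # map (shift \<omega>) [0..<n]"
  by (simp add: map_upt_Suc shift_def del: upt_Suc)

lemma tail_rep_shift: "tail_rep (shift \<omega>) = tail_rep \<omega>"
proof -
  have "(\<exists>m n. (shift ^^ m) (shift \<omega>) = (shift ^^ n) c) \<longleftrightarrow>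
      (\<exists>m n. (shift ^^ m) \<omega> = (shift ^^ n) c)" for c
  proof
    assume "\<exists>m n. (shift ^^ m) (shift \<omega>) = (shift ^^ n) c"
    then obtain m n where "(shift ^^ m) (shift \<omega>) = (shift ^^ n) c" by blast
    then have "(shift ^^ Suc m) \<omega> = (shift ^^ n) c" by (simp add: funpow_swap1)
    then show "\<exists>m n. (shift ^^ m) \<omega> = (shift ^^ n) c" by blast
  next
    assume "\<exists>m n. (shift ^^ m) \<omega> = (shift ^^ n) c"
    then obtain m n where "(shift ^^ m) \<omega> = (shift ^^ n) c" by blast
    then have "(shift ^^ m) (shift \<omega>) = (shift ^^ Suc n) c" by (simp add: funpow_swap1[symmetric])
    then show "\<exists>m n. (shift ^^ m) (shift \<omega>) = (shift ^^ n) c" by blast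
  qed
  then show ?thesis unfolding tail_rep_def by simp
qed

text \<open>
  Having a common tail with a cycle is enough to reach every point of it: after meeting the cycle,
  go on until the number of steps made along it is a multiple of the cycle length.
\<close>

lemma tail_rep_reached:
  assumes "periodic \<omega>"
  shows "cyclic (tail_rep \<omega>) \<and> (\<exists>k. (shift ^^ k) \<omega> = tail_rep \<omega>)"
proof -
  obtain k d where d: "d > 0" "(shift ^^ (d + k)) \<omega> = (shift ^^ k) \<omega>"
  proof -
    obtain k k' where k: "k \<noteq> k'" "(shift ^^ k) \<omega> = (shift ^^ k') \<omega>"
      using assms unfolding periodic_def by blast
    show ?thesis
    proof (cases "k < k'")
      case True
      then show ?thesis using that[of "k' - k" k] k by simp
    next
      case False
      then show ?thesis using that[of "k - k'" k'] k by simp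
    qed
  qed
  have "cyclic ((shift ^^ k) \<omega>)"
    unfolding cyclic_def using d by (intro exI[of _ d]) (simp add: funpow_add)
  moreover have "(shift ^^ k) \<omega> = (shift ^^ 0) ((shift ^^ k) \<omega>)"
    by simp
  ultimately have "\<exists>c. cyclic c \<and> (\<exists>m n. (shift ^^ m) \<omega> = (shift ^^ n) c)"
    by blast
  from someI_ex[OF this] obtain m n where c: "cyclic (tail_rep \<omega>)"
    and mn: "(shift ^^ m) \<omega> = (shift ^^ n) (tail_rep \<omega>)"
    unfolding tail_rep_def[symmetric] by blast
  from c obtain p where p: "p > 0" "(shift ^^ p) (tail_rep \<omega>) = tail_rep \<omega>"
    unfolding cyclic_def by blast
  have return: "(shift ^^ (n * p)) (tail_rep \<omega>) = tail_rep \<omega>"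
    by (induction n) (simp_all add: funpow_add p(2))
  have "(shift ^^ (n * p - n + m)) \<omega> = (shift ^^ (n * p - n + n)) (tail_rep \<omega>)"
    by (simp add: funpow_add mn)
  also have "n * p - n + n = n * p"
    using p(1) by simp
  finally have "(shift ^^ (n * p - n + m)) \<omega> = tail_rep \<omega>"
    using return by simp
  with c show ?thesis by blast
qed

lemma shift_entry_time: "periodic \<omega> \<Longrightarrow> (shift ^^ entry_time \<omega>) \<omega> = tail_rep \<omega>"
  unfolding entry_time_def by (rule LeastI_ex) (use tail_rep_reached in blast)

lemma entry_time_Suc:
  assumes "periodic (shift \<omega>)" "\<omega> \<noteq> tail_rep \<omega>"
  shows "entry_time \<omega> = Suc (entry_time (shift \<omega>))"
proof -
  have "(shift ^^ entry_time \<omega>) \<omega> = tail_rep \<omega>"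
    by (rule shift_entry_time[OF periodic_of_periodic_shift[OF assms(1)]])
  moreover have "\<not> (shift ^^ 0) \<omega> = tail_rep \<omega>"
    using assms(2) by simp
  ultimately have "(LEAST k. (shift ^^ k) \<omega> = tail_rep \<omega>) =
      Suc (LEAST k. (shift ^^ Suc k) \<omega> = tail_rep \<omega>)"
    by (rule Least_Suc[of "\<lambda>k. (shift ^^ k) \<omega> = tail_rep \<omega>"])
  then show ?thesis
    unfolding entry_time_def tail_rep_shift funpow_Suc_right comp_apply .
qed

text \<open>
  Leaving the representative by one shift, one must travel the rest of the cycle to come back. This
  is where the minimal period enters.
\<close>

lemma period_eq_Suc_entry_time:
  assumes "cyclic c" "c = tail_rep c"
  shows "period c = Suc (entry_time (shift c))"
proof -
  have "\<exists>p. p > 0 \<and> (shift ^^ p) c = c"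
    using shift_period[OF assms(1)] by blast
  then obtain p where "p > 0 \<and> (shift ^^ p) c = c" ..
  then have "period c = Suc (LEAST k. Suc k > 0 \<and> (shift ^^ Suc k) c = c)"
    unfolding period_def[of c]
    by (rule Least_Suc[of "\<lambda>p. p > 0 \<and> (shift ^^ p) c = c" p]) simp
  also have "(LEAST k. Suc k > 0 \<and> (shift ^^ Suc k) c = c) = (LEAST k. (shift ^^ k) (shift c) = c)"
    by (simp only: funpow_Suc_right comp_apply zero_less_Suc simp_thms)
  finally show ?thesis
    unfolding entry_time_def tail_rep_shift assms(2)[symmetric] .
qed

section \<open>Atoms of the projection valued measure\<close>

lemma space_borel_words: "space (borel_words N) = words N"
  by (simp add: borel_words_def space_restrict_space)

lemma cylinder_prefix:
  "\<eta> \<in> cylinder N (map \<omega> [0..<n]) \<longleftrightarrow> \<eta> \<in> words N \<and> (\<forall>k<n. \<eta> k = \<omega> k)"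
  by (auto simp: cylinder_def)

lemma closed_coordinate: "closed {\<eta> :: nat \<Rightarrow> nat. \<eta> k = a}"
proof -
  have "continuous_on UNIV (\<lambda>\<eta> :: nat \<Rightarrow> nat. \<eta> k)" by simp
  from continuous_closed_preimage_constant[OF this closed_UNIV, of a] show ?thesis by simp
qed

lemma sets_cylinder: "cylinder N I \<in> sets (borel_words N)"
proof -
  have "cylinder N I = words N \<inter> (\<Inter>k<length I. {\<eta>. \<eta> k = I ! k})"
    by (auto simp: cylinder_def)
  moreover have "closed (\<Inter>k<length I. {\<eta>. \<eta> k = I ! k})"
    by (intro closed_INT ballI closed_coordinate)
  ultimately show ?thesis
    unfolding borel_words_def sets_restrict_space by (auto intro!: imageI borel_closed)
qed

lemma sets_singleton:
  assumes "\<omega> \<in> words N"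
  shows "{\<omega>} \<in> sets (borel_words N)"
proof -
  have "{\<omega>} = words N \<inter> (\<Inter>k. {\<eta>. \<eta> k = \<omega> k})"
    using assms by auto
  moreover have "closed (\<Inter>k. {\<eta>. \<eta> k = \<omega> k})"
    by (intro closed_INT ballI closed_coordinate)
  ultimately show ?thesis
    unfolding borel_words_def sets_restrict_space by (auto intro!: imageI borel_closed)
qed

locale cuntz_pvm =
  fixes N :: nat
    and S :: "nat \<Rightarrow> 'h::complex_hilbert \<Rightarrow> 'h"
    and P :: "(nat \<Rightarrow> nat) set \<Rightarrow> 'h \<Rightarrow> 'h"
  assumes rep: "cuntz_representation N S"
    and pvm: "associated_pvm N S P"
begin

lemma S_clinear: "i < N \<Longrightarrow> bounded_clinear (S i)"
  using rep by (auto simp: cuntz_representation_def)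

lemma sum_S_cadjoint: "(\<Sum>i<N. S i (cadjoint (S i) x)) = x"
  using rep by (auto simp: cuntz_representation_def)

lemma cinner_S:
  assumes "i < N" "j < N"
  shows "cinner (S i x) (S j y) = (if i = j then cinner x y else 0)"
proof -
  have "cadjoint (S j) \<circ> S i = (if j = i then id else (\<lambda>_. 0))"
    using rep assms by (simp add: cuntz_representation_def)
  from fun_cong[OF this, of x] have "cadjoint (S j) (S i x) = (if j = i then x else 0)"
    by (simp split: if_splits)
  then show ?thesis
    by (simp add: cinner_cadjoint[OF S_clinear[OF assms(2)], symmetric])
qed

lemma S_inj:
  assumes "i < N" "S i x = S i y"
  shows "x = y"
proof (rule cinner_ext)
  fix z
  show "cinner x z = cinner y z"
    using cinner_S[OF assms(1,1), of x z] cinner_S[OF assms(1,1), of y z] assms(2) by simp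
qed

lemma word_op_Nil [simp]: "word_op S [] = id"
  by (simp add: word_op_def)

lemma word_op_Cons: "word_op S (i # I) = S i \<circ> word_op S I"
  by (simp add: word_op_def)

lemma word_op_clinear: "set I \<subseteq> {..<N} \<Longrightarrow> bounded_clinear (word_op S I)"
  by (induction I) (simp_all add: word_op_Cons bounded_clinear_id bounded_clinear_compose S_clinear)

lemma cinner_word_op: "set I \<subseteq> {..<N} \<Longrightarrow> cinner (word_op S I x) (word_op S I y) = cinner x y"
  by (induction I) (auto simp: word_op_Cons cinner_S)

lemma prefix_letters: "\<omega> \<in> words N \<Longrightarrow> set (map \<omega> [0..<n]) \<subseteq> {..<N}"
  by (auto simp: words_def)

lemma is_pvm: "projection_valued_measure (borel_words N) P"
  using pvm by (simp add: associated_pvm_def)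

lemma projection: "A \<in> sets (borel_words N) \<Longrightarrow> orthogonal_projection (P A)"
  using is_pvm by (simp add: projection_valued_measure_def)

lemma P_clinear: "A \<in> sets (borel_words N) \<Longrightarrow> bounded_clinear (P A)"
  using projection by (simp add: orthogonal_projection_def)

lemma P_selfadjoint: "A \<in> sets (borel_words N) \<Longrightarrow> cinner (P A x) y = cinner x (P A y)"
  using cinner_cadjoint[OF P_clinear, of A x y] projection[of A]
  by (simp add: orthogonal_projection_def)

lemma P_Int:
  assumes "A \<in> sets (borel_words N)" "B \<in> sets (borel_words N)"
  shows "P (A \<inter> B) x = P A (P B x)"
  using is_pvm assms by (simp add: projection_valued_measure_def)

lemma P_empty: "P {} x = 0"
  using is_pvm by (simp add: projection_valued_measure_def)

lemma P_words: "P (words N) x = x"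
  using is_pvm by (simp add: projection_valued_measure_def space_borel_words)

lemma P_countably_additive:
  "range A \<subseteq> sets (borel_words N) \<Longrightarrow> disjoint_family A \<Longrightarrow> (\<lambda>n::nat. P (A n) x) sums P (\<Union>n. A n) x"
  using is_pvm by (simp add: projection_valued_measure_def)

lemma P_Un:
  assumes "A \<in> sets (borel_words N)" "B \<in> sets (borel_words N)" "A \<inter> B = {}"
  shows "P (A \<union> B) x = P A x + P B x"
proof -
  have "(\<lambda>n. P (binaryset A B n) x) sums P (\<Union>n. binaryset A B n) x"
    using assms
    by (intro P_countably_additive)
      (auto simp: range_binaryset_eq disjoint_family_on_def binaryset_def)
  moreover have "(\<lambda>n. P (binaryset A B n) x) sums (\<Sum>n\<in>{0,1}. P (binaryset A B n) x)"
    by (intro sums_finite) (auto simp: binaryset_def P_empty)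
  ultimately show ?thesis
    by (auto simp: UN_binaryset_eq binaryset_def dest: sums_unique2)
qed

lemma range_P: "A \<in> sets (borel_words N) \<Longrightarrow> x \<in> range (P A) \<longleftrightarrow> P A x = x"
  using P_Int[of A A] by (auto intro: range_eqI[of x "P A" x])

lemma range_P_cylinder:
  assumes "set I \<subseteq> {..<N}"
  shows "range (P (cylinder N I)) = range (word_op S I)"
proof -
  have P: "P (cylinder N I) = word_op S I \<circ> cadjoint (word_op S I)"
    using pvm assms by (simp add: associated_pvm_def)
  have "word_op S I x \<in> range (P (cylinder N I))" for x
    using cadjoint_isometry[OF word_op_clinear cinner_word_op, OF assms assms, of x]
    unfolding P by (intro range_eqI[of _ _ "word_op S I x"]) simp
  then show ?thesis unfolding P by auto
qed

abbreviation atom :: "(nat \<Rightarrow> nat) \<Rightarrow> 'h set" where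
  "atom \<omega> \<equiv> range (P {\<omega>})"

lemma atom_iff_P: "\<omega> \<in> words N \<Longrightarrow> x \<in> atom \<omega> \<longleftrightarrow> P {\<omega>} x = x"
  by (intro range_P sets_singleton)

text \<open>
  The complement of \<open>{\<omega>}\<close> splits into the words that leave \<open>\<omega>\<close> at the \<open>n\<close>-th letter. On a vector
  fixed by all cylinder projections along \<open>\<omega>\<close> each of these pieces projects to zero, so
  by countable additivity the whole vector lies over \<open>{\<omega>}\<close>.
\<close>

lemma atom_iff:
  assumes \<omega>: "\<omega> \<in> words N"
  shows "x \<in> atom \<omega> \<longleftrightarrow> (\<forall>n. x \<in> range (word_op S (map \<omega> [0..<n])))"
proof -
  define C where "C n = cylinder N (map \<omega> [0..<n])" for n
  have C: "C n \<in> sets (borel_words N)" for n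
    unfolding C_def by (rule sets_cylinder)
  have sing: "{\<omega>} \<in> sets (borel_words N)"
    using \<omega> by (rule sets_singleton)
  have range_iff: "x \<in> range (word_op S (map \<omega> [0..<n])) \<longleftrightarrow> P (C n) x = x" for n
    using range_P_cylinder[OF prefix_letters[OF \<omega>]] range_P[OF C[of n]] unfolding C_def by blast
  have "P {\<omega>} x = x \<longleftrightarrow> (\<forall>n. P (C n) x = x)"
  proof
    assume x: "P {\<omega>} x = x"
    show "\<forall>n. P (C n) x = x"
    proof
      fix n
      have "C n \<inter> {\<omega>} = {\<omega>}" using \<omega> by (auto simp: C_def cylinder_prefix)
      then show "P (C n) x = x" using P_Int[OF C[of n] sing, of x] x by simp
    qed
  next
    assume x: "\<forall>n. P (C n) x = x"
    define D where "D n = C n - C (Suc n)" for n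
    have D: "D n \<in> sets (borel_words N)" for n
      unfolding D_def using C by auto
    have "P (D n) x = 0" for n
    proof -
      have "D n \<inter> C (Suc n) = {}" unfolding D_def by blast
      then have "P (D n) (P (C (Suc n)) x) = P {} x"
        by (simp only: P_Int[OF D C, symmetric])
      then show ?thesis using x by (simp add: P_empty)
    qed
    moreover have "disjoint_family D"
    proof -
      have "D m \<inter> D n = {}" if "m < n" for m n
        using that by (auto simp: D_def C_def cylinder_prefix simp del: upt_Suc)
      then show ?thesis
        unfolding disjoint_family_on_def by (metis Int_commute linorder_neqE_nat)
    qed
    ultimately have "(\<lambda>n. 0) sums P (\<Union>n. D n) x"
      using P_countably_additive[of D x] D by auto
    then have 0: "P (\<Union>n. D n) x = 0"
      using sums_zero by (rule sums_unique2)
    have "(\<Union>n. D n) = words N - {\<omega>}"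
    proof
      show "(\<Union>n. D n) \<subseteq> words N - {\<omega>}"
        using \<omega> by (auto simp: D_def C_def cylinder_prefix simp del: upt_Suc)
      show "words N - {\<omega>} \<subseteq> (\<Union>n. D n)"
      proof
        fix \<eta> assume \<eta>: "\<eta> \<in> words N - {\<omega>}"
        define n where "n = (LEAST k. \<eta> k \<noteq> \<omega> k)"
        have "\<exists>k. \<eta> k \<noteq> \<omega> k" using \<eta> by auto
        then have "\<eta> n \<noteq> \<omega> n"
          unfolding n_def by (rule LeastI_ex)
        moreover have "\<eta> k = \<omega> k" if "k < n" for k
          using not_less_Least[of k "\<lambda>k. \<eta> k \<noteq> \<omega> k"] that unfolding n_def by simp
        ultimately have "\<eta> \<in> D n"
          using \<eta> by (auto simp: D_def C_def cylinder_prefix simp del: upt_Suc)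
        then show "\<eta> \<in> (\<Union>n. D n)" by blast
      qed
    qed
    moreover have "(\<Union>n. D n) \<in> sets (borel_words N)" using D by auto
    moreover have "{\<omega>} \<union> (words N - {\<omega>}) = words N" using \<omega> by auto
    ultimately have "P (words N) x = P {\<omega>} x + P (\<Union>n. D n) x"
      using P_Un[OF sing, of "\<Union>n. D n" x] by simp
    then show "P {\<omega>} x = x" using 0 by (simp add: P_words)
  qed
  then show ?thesis
    using atom_iff_P[OF \<omega>] range_iff by simp
qed

text \<open>
  Deleting the first letter shortens every prefix by one and \<open>S (\<omega> 0)\<close> is injective, so the
  intersection of prefix ranges for \<open>\<omega>\<close> is the image of the one for \<open>shift \<omega>\<close>.
\<close>

lemma atom_shift:
  assumes \<omega>: "\<omega> \<in> words N"
  shows "atom \<omega> = S (\<omega> 0) ` atom (shift \<omega>)"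
proof -
  have letter: "\<omega> 0 < N" using \<omega> by (simp add: words_def)
  have step: "S (\<omega> 0) y \<in> range (word_op S (map \<omega> [0..<Suc n])) \<longleftrightarrow>
      y \<in> range (word_op S (map (shift \<omega>) [0..<n]))" for y n
    unfolding prefix_Suc word_op_Cons image_comp[symmetric]
    by (rule inj_image_mem_iff) (auto intro: injI S_inj[OF letter])
  have prefix_0_redundant: "(\<forall>n. x \<in> range (word_op S (map \<omega> [0..<n]))) \<longleftrightarrow>
      (\<forall>n. x \<in> range (word_op S (map \<omega> [0..<Suc n])))" for x
  proof
    assume *: "\<forall>n. x \<in> range (word_op S (map \<omega> [0..<Suc n]))"
    show "\<forall>n. x \<in> range (word_op S (map \<omega> [0..<n]))"
    proof
      fix n show "x \<in> range (word_op S (map \<omega> [0..<n]))"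
        using *[rule_format, of "n - 1"] by (cases n) simp_all
    qed
  qed blast
  have mem: "S (\<omega> 0) y \<in> atom \<omega> \<longleftrightarrow> y \<in> atom (shift \<omega>)" for y
    unfolding atom_iff[OF \<omega>] atom_iff[OF shift_words[OF \<omega>]] step[symmetric]
    by (rule prefix_0_redundant)
  show ?thesis
  proof (rule equalityI; rule subsetI)
    fix x assume x: "x \<in> atom \<omega>"
    then have "x \<in> range (word_op S (map \<omega> [0..<Suc 0]))"
      unfolding atom_iff[OF \<omega>] by (rule spec)
    then obtain y where y: "x = S (\<omega> 0) y"
      unfolding prefix_Suc word_op_Cons by (elim rangeE) simp
    then show "x \<in> S (\<omega> 0) ` atom (shift \<omega>)"
      using x unfolding y by (intro imageI) (simp only: mem)
  next
    fix x assume "x \<in> S (\<omega> 0) ` atom (shift \<omega>)"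
    then obtain y where "x = S (\<omega> 0) y" "y \<in> atom (shift \<omega>)" by (rule imageE)
    then show "x \<in> atom \<omega>" by (simp only: mem)
  qed
qed

lemma atom_shift_funpow:
  "\<omega> \<in> words N \<Longrightarrow> atom \<omega> = word_op S (map \<omega> [0..<k]) ` atom ((shift ^^ k) \<omega>)"
proof (induction k arbitrary: \<omega>)
  case (Suc k)
  have "atom \<omega> = S (\<omega> 0) ` atom (shift \<omega>)"
    using Suc.prems by (rule atom_shift)
  also have "\<dots> = S (\<omega> 0) ` word_op S (map (shift \<omega>) [0..<k]) ` atom ((shift ^^ k) (shift \<omega>))"
    by (simp only: Suc.IH[OF shift_words[OF Suc.prems], symmetric])
  finally show ?case
    by (simp only: prefix_Suc word_op_Cons image_image funpow_Suc_right comp_apply)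
qed simp

lemma atoms_orthogonal:
  assumes "\<omega> \<in> words N" "\<eta> \<in> words N" "\<omega> \<noteq> \<eta>" "x \<in> atom \<omega>" "y \<in> atom \<eta>"
  shows "cinner x y = 0"
proof -
  have "cinner x y = cinner (P {\<omega>} x) (P {\<eta>} y)"
    using assms(4,5) unfolding atom_iff_P[OF assms(1)] atom_iff_P[OF assms(2)] by simp
  also have "\<dots> = cinner x (P ({\<omega>} \<inter> {\<eta>}) y)"
    by (simp only: P_selfadjoint[OF sets_singleton[OF assms(1)]]
        P_Int[OF sets_singleton[OF assms(1)] sets_singleton[OF assms(2)]])
  finally show ?thesis
    using assms(3) by (simp add: P_empty)
qed

lemma closed_atom: "\<omega> \<in> words N \<Longrightarrow> closed (atom \<omega>)"
proof -
  assume \<omega>: "\<omega> \<in> words N"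
  have "atom \<omega> = {x. P {\<omega>} x = x}"
    by (intro set_eqI) (simp only: atom_iff_P[OF \<omega>] mem_Collect_eq)
  moreover have "closed {x. P {\<omega>} x = x}"
    using P_clinear[OF sets_singleton[OF \<omega>]]
    by (intro closed_Collect_eq continuous_on_bounded_clinear continuous_on_id)
  ultimately show ?thesis by simp
qed

lemma subspace_atom:
  assumes \<omega>: "\<omega> \<in> words N"
  shows "complex_vector.subspace (atom \<omega>)"
proof -
  note P = P_clinear[OF sets_singleton[OF \<omega>]]
  show ?thesis
    unfolding complex_vector.subspace_def atom_iff_P[OF \<omega>] Ball_def
    by (simp add: bounded_clinear_zero[OF P] bounded_clinear_add[OF P] bounded_clinear_scaleC[OF P])
qed

section \<open>Permuted bases restrict to atoms\<close>

context
  fixes B :: "'h set"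
  assumes B: "orthonormal_basis_of UNIV B"
    and invariant: "\<And>e j. e \<in> B \<Longrightarrow> j < N \<Longrightarrow> S j e \<in> B"
begin

lemma word_op_basis: "set I \<subseteq> {..<N} \<Longrightarrow> e \<in> B \<Longrightarrow> word_op S I e \<in> B"
  by (induction I) (auto simp: word_op_Cons invariant)

text \<open>
  The vectors \<open>S j b\<close> already form a total orthonormal set; a further basis vector would be
  orthogonal to all of them, hence zero.
\<close>

lemma basis_vector_in_image:
  assumes e: "e \<in> B"
  shows "\<exists>j<N. e \<in> S j ` B"
proof (rule ccontr)
  assume not: "\<not> ?thesis"
  have total: "closure (complex_vector.span B) = UNIV"
    using B by (simp add: orthonormal_basis_of_def)
  have "S j x \<in> {y. cinner e y = 0}" if j: "j < N" for j x
  proof (rule bounded_clinear_closure_span[OF S_clinear[OF j]])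
    show "S j ` B \<subseteq> {y. cinner e y = 0}"
    proof (rule image_subsetI)
      fix b assume b: "b \<in> B"
      then have "S j b \<in> B" "e \<noteq> S j b" using invariant j not by blast+
      then show "S j b \<in> {y. cinner e y = 0}" using B e by (simp add: orthonormal_basis_of_def)
    qed
    show "x \<in> closure (complex_vector.span B)" using total by simp
  qed (rule closed_orthogonal_complement subspace_orthogonal_complement)+
  then have "(\<Sum>j<N. S j (cadjoint (S j) e)) \<in> {y. cinner e y = 0}"
    by (intro complex_vector.subspace_sum[OF subspace_orthogonal_complement]) auto
  then have "cinner e e = 0"
    by (simp only: sum_S_cadjoint mem_Collect_eq)
  moreover have "cinner e e = 1"
    using B e unfolding orthonormal_basis_of_def by metis
  ultimately show False by simp
qed

text \<open>
  Peeling off one letter at a time, a basis vector either follows the word \<open>I\<close> to its end, or branches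
  off at some letter and then lies in the range of a different isometry, orthogonal to the first.
\<close>

lemma basis_vector_dichotomy:
  "set I \<subseteq> {..<N} \<Longrightarrow> e \<in> B \<Longrightarrow>
    e \<in> word_op S I ` B \<or> (\<forall>y. cinner e (word_op S I y) = 0)"
proof (induction I arbitrary: e)
  case (Cons i I)
  obtain j e' where e: "j < N" "e' \<in> B" "e = S j e'"
    using basis_vector_in_image[OF Cons.prems(2)] by blast
  show ?case
  proof (cases "j = i")
    case True
    then show ?thesis
      using Cons.IH[of e'] Cons.prems e by (auto simp: word_op_Cons cinner_S)
  qed (use Cons.prems e in \<open>auto simp: word_op_Cons cinner_S\<close>)
qed simp

lemma basis_vector_in_atom:
  assumes \<omega>: "\<omega> \<in> words N" and e: "e \<in> B"
  shows "e \<in> atom \<omega> \<or> P {\<omega>} e = 0"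
proof (rule disjCI)
  assume "P {\<omega>} e \<noteq> 0"
  have "e \<in> word_op S (map \<omega> [0..<n]) ` B" for n
  proof (rule ccontr)
    assume "\<not> ?thesis"
    then have orth: "\<And>y. cinner e (word_op S (map \<omega> [0..<n]) y) = 0"
      using basis_vector_dichotomy[OF prefix_letters[OF \<omega>] e] by blast
    have "P {\<omega>} e \<in> range (word_op S (map \<omega> [0..<n]))"
      using atom_iff[OF \<omega>, of "P {\<omega>} e"] by blast
    then have "cinner e (P {\<omega>} e) = 0" using orth by auto
    moreover have "cinner (P {\<omega>} e) (P {\<omega>} e) = cinner e (P {\<omega>} e)"
      using P_selfadjoint[OF sets_singleton[OF \<omega>]] atom_iff_P[OF \<omega>] by (metis rangeI)
    ultimately show False using \<open>P {\<omega>} e \<noteq> 0\<close> by simp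
  qed
  then show "e \<in> atom \<omega>"
    unfolding atom_iff[OF \<omega>] by blast
qed

text \<open>
  The projection \<open>P {\<omega>}\<close> keeps the basis vectors inside the atom and kills all others, so
  projecting the total set \<open>B\<close> gives a total set of the atom.
\<close>

lemma basis_of_atom:
  assumes \<omega>: "\<omega> \<in> words N"
  shows "orthonormal_basis_of (atom \<omega>) (B \<inter> atom \<omega>)"
proof (rule orthonormal_basis_ofI)
  let ?M = "closure (complex_vector.span (B \<inter> atom \<omega>))"
  show "atom \<omega> \<subseteq> ?M"
  proof (rule image_subsetI)
    fix x
    have sub: "complex_vector.subspace ?M"
      by (intro subspace_closure complex_vector.subspace_span)
    have "P {\<omega>} ` B \<subseteq> ?M"
    proof (rule image_subsetI)
      fix e assume e: "e \<in> B"
      show "P {\<omega>} e \<in> ?M"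
        using basis_vector_in_atom[OF \<omega> e]
      proof
        assume atom: "e \<in> atom \<omega>"
        with e have "e \<in> ?M" by (intro subsetD[OF subset_closure_span] IntI)
        then show ?thesis using atom unfolding atom_iff_P[OF \<omega>] by simp
      qed (simp add: complex_vector.subspace_0[OF sub])
    qed
    moreover have "x \<in> closure (complex_vector.span B)"
      using B by (simp add: orthonormal_basis_of_def)
    ultimately show "P {\<omega>} x \<in> ?M"
      by (rule bounded_clinear_closure_span[OF P_clinear[OF sets_singleton[OF \<omega>]] closed_closure sub])
  qed
qed (use B closed_atom[OF \<omega>] subspace_atom[OF \<omega>] in \<open>auto simp: orthonormal_basis_of_def\<close>)

lemma cycle_permutes_basis_of_atom:
  assumes \<omega>: "\<omega> \<in> words N" and p: "(shift ^^ p) \<omega> = \<omega>"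
  shows "word_op S (map \<omega> [0..<p]) ` (B \<inter> atom \<omega>) = B \<inter> atom \<omega>"
proof -
  let ?T = "word_op S (map \<omega> [0..<p])"
  note I = prefix_letters[OF \<omega>, of p]
  have atom: "atom \<omega> = ?T ` atom \<omega>"
    using atom_shift_funpow[OF \<omega>, of p] p by simp
  have inj: "x = y" if "?T x = ?T y" for x y
    by (rule cinner_ext) (metis cinner_word_op[OF I] that)
  show ?thesis
  proof
    show "?T ` (B \<inter> atom \<omega>) \<subseteq> B \<inter> atom \<omega>"
      using word_op_basis[OF I] atom by blast
    show "B \<inter> atom \<omega> \<subseteq> ?T ` (B \<inter> atom \<omega>)"
    proof
      fix e assume e: "e \<in> B \<inter> atom \<omega>"
      then obtain y where y: "y \<in> atom \<omega>" "e = ?T y" using atom by blast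
      have "cinner e e = 1"
        using B e unfolding orthonormal_basis_of_def by (metis IntD1)
      then have "cinner e (?T y) \<noteq> 0" using y(2) by simp
      then have "e \<in> ?T ` B"
        using basis_vector_dichotomy[OF I IntD1[OF e]] by blast
      then obtain e' where e': "e' \<in> B" "e = ?T e'" by (rule imageE)
      then have "e' = y" using y inj by blast
      then show "e \<in> ?T ` (B \<inter> atom \<omega>)" using e' y by blast
    qed
  qed
qed

end

section \<open>Bases on cycles spread to a permuted basis\<close>

context
  fixes E :: "(nat \<Rightarrow> nat) \<Rightarrow> 'h set"
  assumes cycle_basis: "\<And>c. c \<in> words N \<Longrightarrow> cyclic c \<Longrightarrow> orthonormal_basis_of (atom c) (E c)"
    and cycle_permutes: "\<And>c. c \<in> words N \<Longrightarrow> cyclic c \<Longrightarrow>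
      word_op S (map c [0..<period c]) ` E c = E c"
begin

text \<open>
  The basis is carried along the shortest path from \<open>\<omega>\<close> to the representative of its cycle. Using one
  path and one representative for each \<open>\<omega>\<close> avoids any comparison between different words that lead
  to the same atom.
\<close>

definition transported_basis :: "(nat \<Rightarrow> nat) \<Rightarrow> 'h set" where
  "transported_basis \<omega> = word_op S (map \<omega> [0..<entry_time \<omega>]) ` E (tail_rep \<omega>)"

lemma tail_rep_words: "\<omega> \<in> words N \<Longrightarrow> periodic \<omega> \<Longrightarrow> tail_rep \<omega> \<in> words N"
  by (metis shift_entry_time shift_funpow_words)

lemma transported_basis_of_atom:
  assumes \<omega>: "\<omega> \<in> words N" "periodic \<omega>"
  shows "orthonormal_basis_of (atom \<omega>) (transported_basis \<omega>)"
proof -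
  note I = prefix_letters[OF \<omega>(1)]
  have atom: "atom \<omega> = word_op S (map \<omega> [0..<entry_time \<omega>]) ` atom (tail_rep \<omega>)"
    using atom_shift_funpow[OF \<omega>(1)] shift_entry_time[OF \<omega>(2)] by metis
  show ?thesis
    unfolding atom transported_basis_def
  proof (rule orthonormal_basis_of_isometric_image[OF _ word_op_clinear[OF I] cinner_word_op[OF I]])
    show "orthonormal_basis_of (atom (tail_rep \<omega>)) (E (tail_rep \<omega>))"
      using cycle_basis tail_rep_words \<omega> tail_rep_reached by blast
    show "closed (word_op S (map \<omega> [0..<entry_time \<omega>]) ` atom (tail_rep \<omega>))"
      using closed_atom[OF \<omega>(1)] atom by simp
  qed
qed

text \<open>
  Prepending a letter extends the shortest path by that letter, except when it arrives at the
  representative itself. Then the path has closed up to one full turn of the cycle, and this is the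
  one place where the invariance of the basis on the cycle is needed.
\<close>

lemma S_transported_basis:
  assumes \<omega>: "\<omega> \<in> words N" "periodic \<omega>" and j: "j < N"
  shows "S j ` transported_basis \<omega> = transported_basis (case_nat j \<omega>)"
proof -
  define \<eta> where "\<eta> = case_nat j \<omega>"
  have \<eta>: "shift \<eta> = \<omega>" "\<eta> 0 = j" "\<eta> \<in> words N"
    using case_nat_words[OF j \<omega>(1)] by (simp_all add: \<eta>_def)
  have per: "periodic \<eta>" using periodic_of_periodic_shift[of \<eta>] \<eta>(1) \<omega>(2) by simp
  have rep: "tail_rep \<eta> = tail_rep \<omega>" using tail_rep_shift[of \<eta>] \<eta>(1) by simp
  have image: "S j ` transported_basis \<omega> =
      word_op S (map \<eta> [0..<Suc (entry_time \<omega>)]) ` E (tail_rep \<omega>)"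
    unfolding transported_basis_def prefix_Suc word_op_Cons \<eta> by (simp add: image_comp)
  show ?thesis
  proof (cases "\<eta> = tail_rep \<eta>")
    case True
    have cyc: "cyclic \<eta>" using tail_rep_reached[OF per] True by simp
    have "entry_time \<eta> = 0"
      unfolding entry_time_def using True by (intro Least_eq_0) simp
    then have "transported_basis \<eta> = E \<eta>"
      using True by (simp add: transported_basis_def)
    moreover have "period \<eta> = Suc (entry_time \<omega>)"
      using period_eq_Suc_entry_time[OF cyc True] \<eta>(1) by simp
    ultimately show ?thesis
      using image cycle_permutes[OF \<eta>(3) cyc] rep True unfolding \<eta>_def[symmetric] by metis
  next
    case False
    then have "entry_time \<eta> = Suc (entry_time \<omega>)"
      using entry_time_Suc[of \<eta>] \<eta>(1) \<omega>(2) by simp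
    then show ?thesis
      using image rep unfolding \<eta>_def[symmetric] by (simp only: transported_basis_def)
  qed
qed

text \<open>
  The union runs over all periodic words and not only over \<open>\<Omega>\<close>, because \<open>\<Omega>\<close> need not be closed under
  prepending letters. Atomicity makes the union total.
\<close>

lemma permutative_of_cycle_bases:
  assumes atomic: "purely_atomic_on P \<Omega>" and \<Omega>: "\<Omega> \<subseteq> words N" "\<forall>\<omega>\<in>\<Omega>. periodic \<omega>"
  shows "permutative N S"
proof -
  define W where "W = {\<omega> \<in> words N. periodic \<omega>}"
  define B where "B = (\<Union>\<omega>\<in>W. transported_basis \<omega>)"
  let ?M = "closure (complex_vector.span B)"
  have onb: "orthonormal_basis_of (atom \<omega>) (transported_basis \<omega>)" if "\<omega> \<in> W" for \<omega>
    using that transported_basis_of_atom by (simp add: W_def)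
  have sub: "complex_vector.subspace ?M"
    by (intro subspace_closure complex_vector.subspace_span)
  have "orthonormal_basis_of UNIV B"
  proof (rule orthonormal_basis_ofI)
    fix x y assume "x \<in> B" "y \<in> B"
    then obtain \<omega> \<eta> where xy: "\<omega> \<in> W" "\<eta> \<in> W" "x \<in> transported_basis \<omega>" "y \<in> transported_basis \<eta>"
      unfolding B_def by blast
    show "cinner x y = (if x = y then 1 else 0)"
    proof (cases "\<omega> = \<eta>")
      case True
      then show ?thesis using onb[OF xy(1)] xy by (simp add: orthonormal_basis_of_def)
    next
      case False
      have "x \<in> atom \<omega>" "y \<in> atom \<eta>"
        using onb[OF xy(1)] onb[OF xy(2)] xy subset_closure_span
        unfolding orthonormal_basis_of_def by blast+
      then have 0: "cinner x y = 0"
        using False xy atoms_orthogonal by (auto simp: W_def)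
      moreover have "cinner x x = 1"
        using onb[OF xy(1)] xy by (simp add: orthonormal_basis_of_def)
      ultimately show ?thesis by auto
    qed
  next
    show "UNIV \<subseteq> ?M"
    proof
      fix x :: 'h
      have atom: "atom \<omega> \<subseteq> ?M" if "\<omega> \<in> \<Omega>" for \<omega>
      proof -
        have "\<omega> \<in> W" using that \<Omega> by (auto simp: W_def)
        then have "transported_basis \<omega> \<subseteq> B" by (auto simp: B_def)
        then have "closure (complex_vector.span (transported_basis \<omega>)) \<subseteq> ?M"
          by (intro closure_mono complex_vector.span_mono)
        then show ?thesis
          using onb[OF \<open>\<omega> \<in> W\<close>] by (simp add: orthonormal_basis_of_def)
      qed
      have "(sum (\<lambda>\<omega>. P {\<omega>} x) \<longlongrightarrow> x) (finite_subsets_at_top \<Omega>)"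
        using atomic by (simp add: purely_atomic_on_def has_sum_def)
      moreover have "\<forall>\<^sub>F F in finite_subsets_at_top \<Omega>. (\<Sum>\<omega>\<in>F. P {\<omega>} x) \<in> ?M"
        using atom by (intro eventually_finite_subsets_at_top_weakI complex_vector.subspace_sum[OF sub]) blast
      ultimately show "x \<in> ?M"
        by (intro Lim_in_closed_set[OF closed_closure]) auto
    qed
  qed (simp_all add: complex_vector.subspace_UNIV)
  moreover have "S j e \<in> B" if "e \<in> B" "j < N" for e j
  proof -
    obtain \<omega> where \<omega>: "\<omega> \<in> W" "e \<in> transported_basis \<omega>"
      using \<open>e \<in> B\<close> unfolding B_def by blast
    then have "S j e \<in> transported_basis (case_nat j \<omega>)"
      using S_transported_basis[of \<omega> j] \<open>j < N\<close> by (auto simp: W_def)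
    moreover have "case_nat j \<omega> \<in> W"
      using \<omega>(1) case_nat_words[OF \<open>j < N\<close>] periodic_of_periodic_shift[of "case_nat j \<omega>"]
      by (simp add: W_def)
    ultimately show ?thesis unfolding B_def by blast
  qed
  ultimately show ?thesis unfolding permutative_def by blast
qed

end

lemma atom_outside_support:
  assumes atomic: "purely_atomic_on P \<Omega>" and \<Omega>: "\<Omega> \<subseteq> words N"
    and \<eta>: "\<eta> \<in> words N" "\<eta> \<notin> \<Omega>"
  shows "atom \<eta> = {0}"
proof -
  have "x = 0" if x: "x \<in> atom \<eta>" for x
  proof -
    have "P {\<omega>} x = 0" if "\<omega> \<in> \<Omega>" for \<omega>
    proof -
      have \<omega>: "\<omega> \<in> words N" "\<omega> \<noteq> \<eta>" using that \<Omega> \<eta> by auto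
      have "P {\<omega>} x = P {\<omega>} (P {\<eta>} x)" using atom_iff_P[OF \<eta>(1)] x by simp
      also have "\<dots> = P ({\<omega>} \<inter> {\<eta>}) x" using \<omega> \<eta> by (simp only: P_Int sets_singleton)
      finally show ?thesis using \<omega> by (simp add: P_empty)
    qed
    then have "((\<lambda>\<omega>. P {\<omega>} x) has_sum 0) \<Omega>" by (rule has_sum_0)
    then show "x = 0"
      using atomic has_sum_unique unfolding purely_atomic_on_def by blast
  qed
  moreover have "0 \<in> atom \<eta>" using complex_vector.subspace_0[OF subspace_atom[OF \<eta>(1)]] .
  ultimately show ?thesis by blast
qed

end

section \<open>The characterisation of permutative representations\<close>

theorem theorem4p14:
  fixes N :: nat
    and S :: "nat \<Rightarrow> 'h::complex_hilbert \<Rightarrow> 'h"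
    and P :: "(nat \<Rightarrow> nat) set \<Rightarrow> 'h \<Rightarrow> 'h"
    and \<Omega> :: "(nat \<Rightarrow> nat) set"
  assumes "N \<ge> 2"
    and "cuntz_representation N S"
    and "associated_pvm N S P"
    and "\<Omega> \<subseteq> words N"
    and "purely_atomic_on P \<Omega>"
    and "\<forall>\<omega>\<in>\<Omega>. periodic \<omega>"
  shows "permutative N S \<longleftrightarrow>
    (\<forall>\<omega>\<in>\<Omega>. \<forall>p>0. (shift ^^ p) \<omega> = \<omega> \<longrightarrow>
       (\<exists>E. orthonormal_basis_of (range (P {\<omega>})) E \<and>
            word_op S (map \<omega> [0..<p]) ` E = E))"
proof -
  interpret cuntz_pvm N S P by (rule cuntz_pvm.intro) fact+
  show ?thesis (is "_ \<longleftrightarrow> ?cycles")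
  proof
    assume "permutative N S"
    then obtain B where B: "orthonormal_basis_of UNIV B" "\<And>e j. e \<in> B \<Longrightarrow> j < N \<Longrightarrow> S j e \<in> B"
      unfolding permutative_def by blast
    show ?cycles
      using basis_of_atom[OF B] cycle_permutes_basis_of_atom[OF B] \<open>\<Omega> \<subseteq> words N\<close> by blast
  next
    assume cycles: ?cycles
    \<comment> \<open>A cycle outside \<open>\<Omega>\<close> carries the zero space, for which the empty basis serves.\<close>
    have "\<exists>E. orthonormal_basis_of (range (P {c})) E \<and> word_op S (map c [0..<period c]) ` E = E"
      if c: "c \<in> words N" "cyclic c" for c
    proof (cases "c \<in> \<Omega>")
      case True
      then show ?thesis using cycles shift_period[OF c(2)] by blast
    next
      case False
      have "orthonormal_basis_of (range (P {c})) {}"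
        using atom_outside_support[OF assms(5,4) c(1) False]
        by (simp add: orthonormal_basis_of_def)
      then show ?thesis by (intro exI[of _ "{}"]) simp
    qed
    then obtain E where "\<And>c. c \<in> words N \<Longrightarrow> cyclic c \<Longrightarrow>
        orthonormal_basis_of (range (P {c})) (E c) \<and> word_op S (map c [0..<period c]) ` E c = E c"
      by metis
    then show "permutative N S"
      using permutative_of_cycle_bases[OF _ _ assms(5,4,6), of E] by blast
  qed
qed

end
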